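(* Let $q\in\mathbb{C}\setminus\{0\}$, ${\cal A}={\cal F}(\mathbb{C}_q^{2|1})$, and let ${\cal U}_q$ be the $\mathbb{Z}_2$-graded algebra dual to ${\cal A}$, with even generators $X,Y$ and odd generator $\nabla$, where the pairing with the basis elements $f=x^my^n\theta^k$ of ${\cal A}$ is $$\langle X,f\rangle=m\,\delta_{k,0},\qquad \langle Y,f\rangle=n\,\delta_{k,0},\qquad \langle\nabla,f\rangle=\delta_{k,1}.$$ Then the generators satisfy the commutation relations $$[X,Y]=0,\quad [X,\nabla]=\nabla,\quad [Y,\nabla]=-\nabla,\quad \nabla^2=0.$$
   Context: ${\cal F}(\mathbb{C}_q^{2|1})$ is the unital associative $\mathbb{Z}_2$-graded $\mathbb{C}$-algebra generated by even $x,y$, their inverses, and odd $\theta$, with relations $xy=yx$, $x\theta=q\theta x$, $y\theta=q\theta y$, $\theta^2=0$; it has basis $\{x^my^n\theta^k: m,n\in\mathbb{Z},\ k\in\{0,1\}\}$ and is a $\mathbb{Z}_2$-graded Hopf algebra with coproduct the algebra homomorphism determined by $\Delta(x)=x\otimes x$, $\Delta(y)=y\otimes y$, $\Delta(\theta)=\theta\otimes x^{-1}y+\mathbf 1\otimes\theta$, where $(a_1\otimes a_2)(b_1\otimes b_2)=(-1)^{p(a_2)p(b_1)}a_1b_1\otimes a_2b_2$, $p$ = parity. Elements of ${\cal U}_q$ are linear functionals on ${\cal A}$; the product in ${\cal U}_q$ is defined by $\langle uv,a\rangle=\langle u\otimes v,\Delta(a)\rangle$ with $\langle u\otimes v,a\otimes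 b\rangle=(-1)^{p(v)p(a)}\langle u,a\rangle\langle v,b\rangle$, and the unit is the counit of ${\cal A}$: $\langle\mathbf 1,f\rangle=\epsilon(f)=\delta_{k,0}$. $[A,B]=AB-BA$ in the relations of the claim. *)

theory Defs
  imports Complex_Main "HOL-Library.Poly_Mapping" "HOL-Library.Function_Algebras"
begin

section \<open>Free complex vector spaces\<close>

text \<open>
  A vector space with basis indexed by a type \<open>'i\<close> is rendered as \<open>'i \<Rightarrow>\<^sub>0 complex\<close>;
  \<open>bas i\<close> is the basis vector with index \<open>i\<close>.  The tensor product of the spaces on \<open>'i\<close>
  and \<open>'j\<close> is the space on \<open>'i \<times> 'j\<close>, with \<open>bas i \<otimes> bas j = bas (i, j)\<close>.
\<close>

definition scl :: "complex \<Rightarrow> ('i \<Rightarrow>\<^sub>0 complex) \<Rightarrow> ('i \<Rightarrow>\<^sub>0 complex)" where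
  "scl c a = Poly_Mapping.map ((*) c) a"

definition bas :: "'i \<Rightarrow> ('i \<Rightarrow>\<^sub>0 complex)" where
  "bas i = Poly_Mapping.single i 1"

definition lin :: "('i \<Rightarrow> ('j \<Rightarrow>\<^sub>0 complex)) \<Rightarrow> ('i \<Rightarrow>\<^sub>0 complex) \<Rightarrow> ('j \<Rightarrow>\<^sub>0 complex)" where
  "lin f a = (\<Sum>i\<in>Poly_Mapping.keys a. scl (Poly_Mapping.lookup a i) (f i))"

definition bilin :: "('i \<Rightarrow> 'j \<Rightarrow> ('k \<Rightarrow>\<^sub>0 complex)) \<Rightarrow>
    ('i \<Rightarrow>\<^sub>0 complex) \<Rightarrow> ('j \<Rightarrow>\<^sub>0 complex) \<Rightarrow> ('k \<Rightarrow>\<^sub>0 complex)" where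
  "bilin f a b = lin (\<lambda>i. lin (f i) b) a"

definition tensor :: "('i \<Rightarrow>\<^sub>0 complex) \<Rightarrow> ('j \<Rightarrow>\<^sub>0 complex) \<Rightarrow> ('i \<times> 'j \<Rightarrow>\<^sub>0 complex)"
    (infixr "\<otimes>" 75) where
  "a \<otimes> b = bilin (\<lambda>i j. bas (i, j)) a b"

lemma lookup_scl [simp]: "Poly_Mapping.lookup (scl c a) i = c * Poly_Mapping.lookup a i"
  unfolding scl_def by (simp add: Poly_Mapping.map.rep_eq when_def)

interpretation scl: vector_space scl
  by standard (auto intro!: poly_mapping_eqI simp: lookup_add algebra_simps)

lemma scl_single: "scl c (Poly_Mapping.single i d) = Poly_Mapping.single i (c * d)"
  by (auto intro!: poly_mapping_eqI simp: lookup_single when_def)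

lemma single_eq_scl_bas: "Poly_Mapping.single i c = scl c (bas i)"
  by (simp add: bas_def scl_single)

lemma expand: "a = (\<Sum>i\<in>Poly_Mapping.keys a. scl (Poly_Mapping.lookup a i) (bas i))"
proof (rule poly_mapping_eqI)
  fix k
  have "(\<Sum>i\<in>Poly_Mapping.keys a. Poly_Mapping.lookup a i * (if i = k then 1 else 0))
      = (\<Sum>i\<in>Poly_Mapping.keys a. if k = i then Poly_Mapping.lookup a i else 0)"
    by (rule sum.cong) auto
  also have "\<dots> = Poly_Mapping.lookup a k"
    by (simp add: in_keys_iff)
  finally show "Poly_Mapping.lookup a k = Poly_Mapping.lookup
      (\<Sum>i\<in>Poly_Mapping.keys a. scl (Poly_Mapping.lookup a i) (bas i)) k"
    by (simp add: lookup_sum bas_def lookup_single when_def)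
qed

lemma linear_ext:
  assumes f: "Vector_Spaces.linear scl S f" and g: "Vector_Spaces.linear scl S g"
    and "\<And>i. f (bas i) = g (bas i)"
  shows "f = g"
proof
  fix a
  interpret f: Vector_Spaces.linear scl S f by fact
  interpret g: Vector_Spaces.linear scl S g by fact
  have "f a = (\<Sum>i\<in>Poly_Mapping.keys a. S (Poly_Mapping.lookup a i) (f (bas i)))"
    by (subst expand) (simp add: f.sum f.scale)
  also have "\<dots> = g a"
    by (subst (2) expand) (simp add: g.sum g.scale assms(3))
  finally show "f a = g a" .
qed

lemma linear_extend:
  fixes S :: "complex \<Rightarrow> 'b::ab_group_add \<Rightarrow> 'b" and f :: "'i \<Rightarrow> 'b"
  assumes "vector_space S"
  defines "F \<equiv> \<lambda>a :: 'i \<Rightarrow>\<^sub>0 complex. \<Sum>i\<in>Poly_Mapping.keys a. S (Poly_Mapping.lookup a i) (f i)"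
  shows "Vector_Spaces.linear scl S F" and "F (bas i) = f i"
proof -
  interpret S: vector_space S by fact
  have sup: "F a = (\<Sum>i\<in>B. S (Poly_Mapping.lookup a i) (f i))"
    if "finite B" "Poly_Mapping.keys a \<subseteq> B" for a B
    unfolding F_def using that by (intro sum.mono_neutral_left) (auto simp: in_keys_iff)
  show "Vector_Spaces.linear scl S F"
  proof
    fix a b :: "'i \<Rightarrow>\<^sub>0 complex"
    let ?B = "Poly_Mapping.keys a \<union> Poly_Mapping.keys b"
    have "F (a + b) = (\<Sum>i\<in>?B. S (Poly_Mapping.lookup (a + b) i) (f i))"
      by (rule sup) (use keys_add[of a b] in auto)
    also have "\<dots> = F a + F b"
      by (simp add: sup[of ?B a] sup[of ?B b] lookup_add S.scale_left_distrib sum.distrib)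
    finally show "F (a + b) = F a + F b" .
  next
    fix c a
    have "F (scl c a) = (\<Sum>i\<in>Poly_Mapping.keys a. S (Poly_Mapping.lookup (scl c a) i) (f i))"
      by (rule sup) (auto simp: in_keys_iff)
    also have "\<dots> = S c (F a)"
      by (simp add: F_def S.scale_sum_right)
    finally show "F (scl c a) = S c (F a)" .
  qed
  show "F (bas i) = f i"
    by (simp add: F_def bas_def)
qed

lemma linear_lin: "Vector_Spaces.linear scl scl (lin f)"
  unfolding lin_def by (rule linear_extend) (rule scl.vector_space_axioms)

lemma lin_bas [simp]: "lin f (bas i) = f i"
  unfolding lin_def by (rule linear_extend) (rule scl.vector_space_axioms)

lemma lin_add: "lin f (a + b) = lin f a + lin f b"
  and lin_scl: "lin f (scl c a) = scl c (lin f a)"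
  and lin_zero [simp]: "lin f 0 = 0"
proof -
  interpret Vector_Spaces.linear scl scl "lin f" by (rule linear_lin)
  show "lin f (a + b) = lin f a + lin f b" "lin f (scl c a) = scl c (lin f a)" "lin f 0 = 0"
    by (simp_all add: add scale)
qed

lemma lin_fun_add: "lin (\<lambda>i. f i + g i) a = lin f a + lin g a"
  by (simp add: lin_def scl.scale_right_distrib sum.distrib)

lemma lin_fun_scl: "lin (\<lambda>i. scl c (f i)) a = scl c (lin f a)"
  by (simp add: lin_def scl.scale_sum_right mult.commute)

lemma bilin_bas [simp]: "bilin f (bas i) (bas j) = f i j"
  by (simp add: bilin_def)

lemma bilin_add_left: "bilin f (a + a') b = bilin f a b + bilin f a' b"
  and bilin_add_right: "bilin f a (b + b') = bilin f a b + bilin f a b'"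
  and bilin_scl_left: "bilin f (scl c a) b = scl c (bilin f a b)"
  and bilin_scl_right: "bilin f a (scl c b) = scl c (bilin f a b)"
  by (simp_all add: bilin_def lin_add lin_scl lin_fun_add lin_fun_scl)

lemma bilin_zero_left [simp]: "bilin f 0 b = 0"
  and bilin_zero_right [simp]: "bilin f a 0 = 0"
  using bilin_scl_left[of f 0 0 b] bilin_scl_right[of f a 0 0] by simp_all

lemma bilin_minus_left [simp]: "bilin f (- a) b = - bilin f a b"
  and bilin_minus_right [simp]: "bilin f a (- b) = - bilin f a b"
  using bilin_scl_left[of f "-1" a b] bilin_scl_right[of f a "-1" b] by simp_all

lemmas bilin_simps = bilin_add_left bilin_add_right bilin_scl_left bilin_scl_right

lemma linear_bilin:
  "Vector_Spaces.linear scl scl (bilin f a)" "Vector_Spaces.linear scl scl (\<lambda>a. bilin f a b)"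
  by (unfold_locales; simp add: bilin_simps)+

lemma tensor_zero [simp]: "0 \<otimes> b = 0" "a \<otimes> 0 = 0"
  by (simp_all add: tensor_def)

lemma bas_tensor_bas [simp]: "bas i \<otimes> bas j = bas (i, j)"
  by (simp add: tensor_def)


section \<open>Associative unital algebras\<close>

text \<open>
  The product of the algebra below depends on the parameter \<open>q\<close>, so algebras are given by explicit
  operations: scalar multiplication \<open>S\<close>, product \<open>M\<close>, unit \<open>I\<close>.
\<close>

locale calgebra = vector_space S
  for S :: "complex \<Rightarrow> 'b::ab_group_add \<Rightarrow> 'b" +
  fixes M :: "'b \<Rightarrow> 'b \<Rightarrow> 'b" and I :: 'b
  assumes add_left: "M (a + b) c = M a c + M b c"
    and add_right: "M a (b + c) = M a b + M a c"
    and scale_left: "M (S r a) b = S r (M a b)"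
    and scale_right: "M a (S r b) = S r (M a b)"
    and assoc: "M (M a b) c = M a (M b c)"
    and unit_left [simp]: "M I a = a"
    and unit_right [simp]: "M a I = a"

definition alg_hom :: "(complex \<Rightarrow> 'a \<Rightarrow> 'a) \<Rightarrow> ('a \<Rightarrow> 'a \<Rightarrow> 'a) \<Rightarrow> 'a \<Rightarrow>
    (complex \<Rightarrow> 'b \<Rightarrow> 'b) \<Rightarrow> ('b \<Rightarrow> 'b \<Rightarrow> 'b) \<Rightarrow> 'b \<Rightarrow>
    ('a::ab_group_add \<Rightarrow> 'b::ab_group_add) \<Rightarrow> bool" where
  "alg_hom S M I S' M' I' \<phi> \<longleftrightarrow>
     Vector_Spaces.linear S S' \<phi> \<and> \<phi> I = I' \<and> (\<forall>a b. \<phi> (M a b) = M' (\<phi> a) (\<phi> b))"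

definition npow :: "('b \<Rightarrow> 'b \<Rightarrow> 'b) \<Rightarrow> 'b \<Rightarrow> 'b \<Rightarrow> nat \<Rightarrow> 'b" where
  "npow M I a n = (M a ^^ n) I"

text \<open>Integer powers of \<open>a\<close>, where \<open>a'\<close> is the inverse of \<open>a\<close>.\<close>

definition zpow :: "('b \<Rightarrow> 'b \<Rightarrow> 'b) \<Rightarrow> 'b \<Rightarrow> 'b \<Rightarrow> 'b \<Rightarrow> int \<Rightarrow> 'b" where
  "zpow M I a a' m = (if m \<ge> 0 then npow M I a (nat m) else npow M I a' (nat (- m)))"

text \<open>\<open>x\<close>, \<open>y\<close> with inverses \<open>x'\<close>, \<open>y'\<close> and \<open>t\<close> satisfy the defining relations of the
  function algebra of the \<open>q\<close>-superplane.\<close>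

definition superplane_relations :: "(complex \<Rightarrow> 'b \<Rightarrow> 'b) \<Rightarrow> ('b \<Rightarrow> 'b \<Rightarrow> 'b) \<Rightarrow> 'b \<Rightarrow>
    complex \<Rightarrow> 'b::zero \<Rightarrow> 'b \<Rightarrow> 'b \<Rightarrow> 'b \<Rightarrow> 'b \<Rightarrow> bool" where
  "superplane_relations S M I q x x' y y' t \<longleftrightarrow>
     M x x' = I \<and> M x' x = I \<and> M y y' = I \<and> M y' y = I \<and>
     M x y = M y x \<and> M x t = S q (M t x) \<and> M y t = S q (M t y) \<and> M t t = 0"

lemma npow_simps [simp]: "npow M I a 0 = I" "npow M I a (Suc n) = M a (npow M I a n)"
  by (simp_all add: npow_def)

lemma zpow_0 [simp]: "zpow M I a a' 0 = I"
  by (simp add: zpow_def)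

context calgebra
begin

lemma zero_left [simp]: "M 0 a = 0"
  using scale_left[of 0 0 a] by simp

lemma zero_right [simp]: "M a 0 = 0"
  using scale_right[of a 0 0] by simp

lemma inv_cancel: "M a a' = I \<Longrightarrow> M a (M a' b) = b"
  by (metis assoc unit_left)

lemma zpow_1: "zpow M I a a' 1 = a" "zpow M I a a' (-1) = a'"
  by (simp_all add: zpow_def)

lemma zpow_Suc:
  assumes "M a a' = I"
  shows "zpow M I a a' (m + 1) = M a (zpow M I a a' m)"
proof (cases "m \<ge> 0")
  case True
  then show ?thesis by (simp add: zpow_def nat_add_distrib)
next
  case False
  then obtain n where "m = - int (Suc n)"
    by (metis not_le zero_less_imp_eq_int minus_minus neg_0_less_iff_less gr0_conv_Suc)
  then show ?thesis
    by (cases n) (simp_all add: zpow_def inv_cancel[OF assms] assms nat_add_distrib)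
qed

lemma zpow_pred:
  assumes "M a a' = I" "M a' a = I"
  shows "zpow M I a a' (m - 1) = M a' (zpow M I a a' m)"
  using zpow_Suc[OF assms(1), of "m - 1"] by (simp add: inv_cancel[OF assms(2)])

lemma zpow_add:
  assumes "M a a' = I" "M a' a = I"
  shows "M (zpow M I a a' m) (zpow M I a a' n) = zpow M I a a' (m + n)"
proof (induction m rule: int_induct[where k = 0])
  case (step1 i)
  then show ?case
    using zpow_Suc[OF assms(1), of i] zpow_Suc[OF assms(1), of "i + n"]
    by (simp add: assoc add.assoc add.commute[of n 1])
next
  case (step2 i)
  then show ?case
    using zpow_pred[OF assms, of i] zpow_pred[OF assms, of "i + n"]
    by (simp add: assoc diff_add_eq)
qed simp

lemma twisted_inv:
  assumes "M a a' = I" "M a' a = I" "M z a = S c (M a z)" "c \<noteq> 0"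
  shows "M z a' = S (inverse c) (M a' z)"
proof -
  have "M a' z = M a' (M (M z a) a')"
    by (simp only: assoc assms(1) inv_cancel[OF assms(2)] unit_right)
  also have "\<dots> = S c (M z a')"
    by (simp add: assms(3) scale_left scale_right assoc inv_cancel[OF assms(2)])
  finally show ?thesis
    using assms(4) by simp
qed

lemma twisted_zpow:
  assumes "M a a' = I" "M a' a = I" "M z a = S c (M a z)" "c \<noteq> 0"
  shows "M z (zpow M I a a' m) = S (c powi m) (M (zpow M I a a' m) z)"
proof (induction m rule: int_induct[where k = 0])
  case (step1 i)
  have "M z (zpow M I a a' (i + 1)) = M (M z a) (zpow M I a a' i)"
    by (simp add: zpow_Suc[OF assms(1)] assoc)
  then show ?case
    using step1 assms(4)
    by (simp add: assms(3) scale_left scale_right assoc zpow_Suc[OF assms(1)] power_int_add_1 mult.commute)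
next
  case (step2 i)
  have "M z (zpow M I a a' (i - 1)) = M (M z a') (zpow M I a a' i)"
    by (simp add: zpow_pred[OF assms(1,2)] assoc)
  then show ?case
    using step2 assms(4)
    by (simp add: twisted_inv[OF assms] scale_left scale_right assoc zpow_pred[OF assms(1,2)]
        power_int_diff field_simps)
qed simp

end


section \<open>The function algebra of the quantum superplane\<close>

text \<open>
  The index \<open>(m, n, k)\<close> stands for the monomial \<open>x\<^sup>m y\<^sup>n \<theta>\<^sup>k\<close>, where the boolean \<open>k\<close>
  is the exponent of \<open>\<theta>\<close>.  The product is the one forced by
  \<open>\<theta> x\<^sup>m y\<^sup>n = q\<^bsup>-(m+n)\<^esup> x\<^sup>m y\<^sup>n \<theta>\<close> and \<open>\<theta>\<^sup>2 = 0\<close>; theorem \<open>superplane_universal\<close> shows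
  that the result is the algebra presented by the generators and relations.
\<close>

type_synonym idx = "int \<times> int \<times> bool"
type_synonym superplane = "idx \<Rightarrow>\<^sub>0 complex"

fun bmul :: "complex \<Rightarrow> idx \<Rightarrow> idx \<Rightarrow> superplane" where
  "bmul q (m, n, k) (m', n', k') = Poly_Mapping.single (m + m', n + n', k \<or> k')
     (if k \<and> k' then 0 else if k then q powi (- (m' + n')) else 1)"

definition amul :: "complex \<Rightarrow> superplane \<Rightarrow> superplane \<Rightarrow> superplane" where
  "amul q = bilin (bmul q)"

definition aone :: superplane where "aone = bas (0, 0, False)"
definition gx :: superplane where "gx = bas (1, 0, False)"
definition gx_inv :: superplane where "gx_inv = bas (-1, 0, False)"
definition gy :: superplane where "gy = bas (0, 1, False)"
definition gy_inv :: superplane where "gy_inv = bas (0, -1, False)"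
definition gtheta :: superplane where "gtheta = bas (0, 0, True)"

definition monomial :: "complex \<Rightarrow> int \<Rightarrow> int \<Rightarrow> nat \<Rightarrow> superplane" where
  "monomial q m n k =
     amul q (amul q (zpow (amul q) aone gx gx_inv m) (zpow (amul q) aone gy gy_inv n))
       (npow (amul q) aone gtheta k)"

text \<open>\<open>True\<close> is the odd parity.\<close>

fun parity :: "idx \<Rightarrow> bool" where "parity (m, n, k) = k"

definition homogeneous :: "bool \<Rightarrow> superplane \<Rightarrow> bool" where
  "homogeneous p a \<longleftrightarrow> (\<forall>i\<in>Poly_Mapping.keys a. parity i = p)"

definition ssign :: "bool \<Rightarrow> bool \<Rightarrow> complex" where
  "ssign p p' = (if p \<and> p' then - 1 else 1)"

text \<open>The graded product on the tensor square is given here on basis vectors; lemma \<open>tmul_tensor\<close>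
  is the sign rule for homogeneous tensors.\<close>

definition tmul :: "complex \<Rightarrow> (idx \<times> idx \<Rightarrow>\<^sub>0 complex) \<Rightarrow> (idx \<times> idx \<Rightarrow>\<^sub>0 complex) \<Rightarrow>
    (idx \<times> idx \<Rightarrow>\<^sub>0 complex)" where
  "tmul q = bilin (\<lambda>(a1, a2) (b1, b2).
     scl (ssign (parity a2) (parity b1)) (amul q (bas a1) (bas b1) \<otimes> amul q (bas a2) (bas b2)))"

definition tone :: "idx \<times> idx \<Rightarrow>\<^sub>0 complex" where "tone = aone \<otimes> aone"

lemma amul_bas: "amul q (bas i) (bas j) = bmul q i j"
  by (simp add: amul_def)

lemma trilinear_ext:
  fixes M :: "('i \<Rightarrow>\<^sub>0 complex) \<Rightarrow> ('i \<Rightarrow>\<^sub>0 complex) \<Rightarrow> ('i \<Rightarrow>\<^sub>0 complex)"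
  assumes M: "M = bilin f"
    and basis: "\<And>i j k. M (M (bas i) (bas j)) (bas k) = M (bas i) (M (bas j) (bas k))"
  shows "M (M a b) c = M a (M b c)"
proof -
  note s = bilin_simps
  have 1: "M (M (bas i) (bas j)) c = M (bas i) (M (bas j) c)" for i j c
    by (rule fun_cong[where x = c], rule linear_ext[where S = scl])
      (use basis M in \<open>unfold_locales; simp add: s\<close>)+
  have 2: "M (M (bas i) b) c = M (bas i) (M b c)" for i b c
    by (rule fun_cong[where x = b], rule linear_ext[where S = scl])
      (use 1 M in \<open>unfold_locales; simp add: s\<close>)+
  show ?thesis
    by (rule fun_cong[where x = a], rule linear_ext[where S = scl])
      (use 2 M in \<open>unfold_locales; simp add: s\<close>)+
qed

lemma unit_ext:
  assumes M: "M = bilin f" and "\<And>i. M u (bas i) = bas i" "\<And>i. M (bas i) u = bas i"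
  shows "M u a = a" "M a u = a"
  by (rule fun_cong[where x = a], rule linear_ext[where S = scl];
      use assms in \<open>unfold_locales; simp add: bilin_simps\<close>)+

lemma superplane_calgebra:
  assumes "q \<noteq> 0"
  shows "calgebra scl (amul q) aone"
proof unfold_locales
  fix a b c :: superplane
  show "amul q (amul q a b) c = amul q a (amul q b c)"
  proof (rule trilinear_ext[OF amul_def])
    fix i j k :: idx
    show "amul q (amul q (bas i) (bas j)) (bas k) = amul q (bas i) (amul q (bas j) (bas k))"
      by (cases i; cases j; cases k)
        (use assms in \<open>auto simp: amul_def single_eq_scl_bas bilin_simps power_int_add
          power_int_minus power_int_diff field_simps\<close>)
  qed
  have "amul q aone (bas i) = bas i" "amul q (bas i) aone = bas i" for i
    by (cases i; simp add: amul_def aone_def single_eq_scl_bas)+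
  from unit_ext[OF amul_def this] show "amul q aone a = a" "amul q a aone = a" .
qed (simp_all add: amul_def bilin_simps)

lemma superplane_satisfies_relations:
  assumes "q \<noteq> 0"
  shows "superplane_relations scl (amul q) aone q gx gx_inv gy gy_inv gtheta"
  using assms
  by (simp add: superplane_relations_def amul_def gx_def gx_inv_def gy_def gy_inv_def gtheta_def
      aone_def single_eq_scl_bas power_int_minus)


lemma zpow_gx:
  assumes "q \<noteq> 0"
  shows "zpow (amul q) aone gx gx_inv m = bas (m, 0, False)"
proof -
  interpret calgebra scl "amul q" aone by (rule superplane_calgebra) fact
  have inv: "amul q gx gx_inv = aone" "amul q gx_inv gx = aone"
    using superplane_satisfies_relations[OF assms] by (auto simp: superplane_relations_def)
  show ?thesis
    by (induction m rule: int_induct[where k = 0])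
      (simp_all add: zpow_Suc[OF inv(1)] zpow_pred[OF inv],
       simp_all add: aone_def gx_def gx_inv_def amul_bas single_eq_scl_bas add.commute)
qed

lemma zpow_gy:
  assumes "q \<noteq> 0"
  shows "zpow (amul q) aone gy gy_inv n = bas (0, n, False)"
proof -
  interpret calgebra scl "amul q" aone by (rule superplane_calgebra) fact
  have inv: "amul q gy gy_inv = aone" "amul q gy_inv gy = aone"
    using superplane_satisfies_relations[OF assms] by (auto simp: superplane_relations_def)
  show ?thesis
    by (induction n rule: int_induct[where k = 0])
      (simp_all add: zpow_Suc[OF inv(1)] zpow_pred[OF inv],
       simp_all add: aone_def gy_def gy_inv_def amul_bas single_eq_scl_bas add.commute)
qed

lemma monomial_eq_bas:
  assumes "q \<noteq> 0"
  shows "monomial q m n 0 = bas (m, n, False)" "monomial q m n 1 = bas (m, n, True)"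
proof -
  interpret calgebra scl "amul q" aone by (rule superplane_calgebra) fact
  show "monomial q m n 0 = bas (m, n, False)" "monomial q m n 1 = bas (m, n, True)"
    using assms
    by (simp_all add: monomial_def zpow_gx zpow_gy,
        simp_all add: amul_bas single_eq_scl_bas gtheta_def)
qed

text \<open>The algebra is presented by its generators and relations: elements of any algebra that satisfy
  the relations are the images of the generators under exactly one algebra homomorphism.\<close>

theorem superplane_universal:
  assumes q: "q \<noteq> 0" and alg: "calgebra S M I"
    and rel: "superplane_relations S M I q x x' y y' t"
  shows "\<exists>!\<phi>. alg_hom scl (amul q) aone S M I \<phi> \<and> \<phi> gx = x \<and> \<phi> gy = y \<and> \<phi> gtheta = t"
proof -
  interpret A: calgebra scl "amul q" aone by (rule superplane_calgebra) fact
  interpret calgebra S M I by fact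
  have xi: "M x x' = I" "M x' x = I" and yi: "M y y' = I" "M y' y = I"
    and xy: "M x y = M y x" and xt: "M x t = S q (M t x)" and yt: "M y t = S q (M t y)"
    and tt: "M t t = 0"
    using rel by (auto simp: superplane_relations_def)
  have gxi: "amul q gx gx_inv = aone" "amul q gx_inv gx = aone"
    and gyi: "amul q gy gy_inv = aone" "amul q gy_inv gy = aone"
    using superplane_satisfies_relations[OF q] by (auto simp: superplane_relations_def)
  let ?X = "zpow M I x x'" and ?Y = "zpow M I y y'"
  have tX: "M t (?X m) = S (inverse q powi m) (M (?X m) t)" for m
    by (rule twisted_zpow[OF xi]) (use xt q in auto)
  have tY: "M t (?Y m) = S (inverse q powi m) (M (?Y m) t)" for m
    by (rule twisted_zpow[OF yi]) (use yt q in auto)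
  have "M y (?X m) = S (1 powi m) (M (?X m) y)" for m
    by (rule twisted_zpow[OF xi]) (use xy in auto)
  then have "M (?X m) y = S 1 (M y (?X m))" for m
    by simp
  then have "M (?X m) (?Y n) = S (1 powi n) (M (?Y n) (?X m))" for m n
    by (rule twisted_zpow[OF yi]) simp
  then have YX: "M (?Y n) (?X m) = M (?X m) (?Y n)" for m n
    by simp
  define f where "f = (\<lambda>(m, n, k). M (M (?X m) (?Y n)) (if k then t else I))"
  define \<phi> where "\<phi> a = (\<Sum>i\<in>Poly_Mapping.keys a. S (Poly_Mapping.lookup a i) (f i))" for a
  have lin: "Vector_Spaces.linear scl S \<phi>" and \<phi>_bas: "\<phi> (bas i) = f i" for i
    unfolding \<phi>_def by (rule linear_extend, rule vector_space_axioms)+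
  interpret \<phi>: Vector_Spaces.linear scl S \<phi> by fact
  have YX2: "M (?Y n) (M (?X m) c) = M (?X m) (M (?Y n) c)" for n m c
    by (metis YX assoc)
  have tX2: "M t (M (?X m) c) = S (inverse q powi m) (M (?X m) (M t c))" for m c
    by (metis tX assoc scale_left)
  have tY2: "M t (M (?Y m) c) = S (inverse q powi m) (M (?Y m) (M t c))" for m c
    by (metis tY assoc scale_left)
  have X2: "M (?X m) (M (?X n) c) = M (?X (m + n)) c" for m n c
    by (metis zpow_add[OF xi] assoc)
  have Y2: "M (?Y m) (M (?Y n) c) = M (?Y (m + n)) c" for m n c
    by (metis zpow_add[OF yi] assoc)
  have mult_bas: "\<phi> (amul q (bas i) (bas j)) = M (\<phi> (bas i)) (\<phi> (bas j))" for i j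
  proof -
    obtain m n k m' n' k' where ij: "i = (m, n, k)" "j = (m', n', k')"
      by (metis prod_cases3)
    show ?thesis
      using q unfolding ij
      by (cases k; cases k')
        (simp_all add: amul_bas single_eq_scl_bas \<phi>.scale \<phi>_bas f_def assoc YX2 tX2 tY2 X2 Y2
          zpow_add[OF xi] zpow_add[OF yi] tX tY tt scale_left scale_right YX
          power_int_add power_int_minus power_int_diff power_int_inverse divide_inverse mult.commute)
  qed
  have 1: "\<phi> (amul q (bas i) b) = M (\<phi> (bas i)) (\<phi> b)" for i b
    by (rule fun_cong[where x = b], rule linear_ext[where S = S])
      (use mult_bas in \<open>unfold_locales;
        simp add: A.add_right A.scale_right add_right scale_right \<phi>.add \<phi>.scale\<close>)+
  have mult: "\<phi> (amul q a b) = M (\<phi> a) (\<phi> b)" for a b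
    by (rule fun_cong[where x = a], rule linear_ext[where S = S])
      (use 1 in \<open>unfold_locales;
        simp add: A.add_left A.scale_left add_left scale_left \<phi>.add \<phi>.scale\<close>)+
  show ?thesis
  proof (rule ex1I)
    show "alg_hom scl (amul q) aone S M I \<phi> \<and> \<phi> gx = x \<and> \<phi> gy = y \<and> \<phi> gtheta = t"
      using lin mult
      by (simp add: alg_hom_def aone_def gx_def gy_def gtheta_def \<phi>_bas f_def zpow_1)
  next
    fix \<psi>
    assume \<psi>: "alg_hom scl (amul q) aone S M I \<psi> \<and> \<psi> gx = x \<and> \<psi> gy = y \<and> \<psi> gtheta = t"
    then have lin\<psi>: "Vector_Spaces.linear scl S \<psi>" and one: "\<psi> aone = I"
      and mul: "\<psi> (amul q a b) = M (\<psi> a) (\<psi> b)" for a b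
      by (auto simp: alg_hom_def)
    have gxi': "\<psi> gx_inv = x'"
      by (metis \<psi> assoc gxi(1) mul one unit_left unit_right xi(2))
    have gyi': "\<psi> gy_inv = y'"
      by (metis \<psi> assoc gyi(1) mul one unit_left unit_right yi(2))
    have X: "\<psi> (zpow (amul q) aone gx gx_inv m) = ?X m" for m
      by (induction m rule: int_induct[where k = 0])
        (simp_all add: one mul \<psi> gxi' A.zpow_Suc[OF gxi(1)] A.zpow_pred[OF gxi]
          zpow_Suc[OF xi(1)] zpow_pred[OF xi])
    have Y: "\<psi> (zpow (amul q) aone gy gy_inv m) = ?Y m" for m
      by (induction m rule: int_induct[where k = 0])
        (simp_all add: one mul \<psi> gyi' A.zpow_Suc[OF gyi(1)] A.zpow_pred[OF gyi]
          zpow_Suc[OF yi(1)] zpow_pred[OF yi])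
    have "\<psi> (bas i) = \<phi> (bas i)" for i
    proof -
      obtain m n k where i: "i = (m, n, k)" by (metis prod_cases3)
      have "\<psi> (monomial q m n (if k then 1 else 0)) = f i"
        using \<psi> by (simp add: i f_def monomial_def mul X Y one)
      then show ?thesis
        by (cases k) (simp_all add: i \<phi>_bas monomial_eq_bas[OF q, simplified])
    qed
    then show "\<psi> = \<phi>"
      by (rule linear_ext[OF lin\<psi> lin])
  qed
qed


section \<open>The graded tensor square and the coproduct\<close>

lemma tensor_simps:
  "(a + a') \<otimes> b = a \<otimes> b + a' \<otimes> b" "a \<otimes> (b + b') = a \<otimes> b + a \<otimes> b'"
  "scl c a \<otimes> b = scl c (a \<otimes> b)" "a \<otimes> scl c b = scl c (a \<otimes> b)"
  by (simp_all add: tensor_def bilin_simps)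

lemma tmul_bas:
  "tmul q (bas (i, j)) (bas (k, l)) =
     scl (ssign (parity j) (parity k)) (bmul q i k \<otimes> bmul q j l)"
  by (simp add: tmul_def amul_bas)

lemma homogeneous_induct [consumes 1, case_names zero add bas]:
  assumes "homogeneous p a"
    and zero: "P 0" and add: "\<And>a b. P a \<Longrightarrow> P b \<Longrightarrow> P (a + b)"
    and bas: "\<And>c i. parity i = p \<Longrightarrow> P (scl c (bas i))"
  shows "P a"
proof -
  have "P (\<Sum>i\<in>A. scl (Poly_Mapping.lookup a i) (bas i))"
    if "finite A" "A \<subseteq> Poly_Mapping.keys a" for A
    using that
  proof (induction A rule: finite_induct)
    case (insert i A)
    then show ?case
      using assms(1) by (auto simp: homogeneous_def intro!: add bas)
  qed (simp add: zero)
  from this[of "Poly_Mapping.keys a"] show ?thesis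
    by (simp flip: expand)
qed

lemma tmul_tensor:
  assumes "homogeneous p a2" "homogeneous p' b1"
  shows "tmul q (a1 \<otimes> a2) (b1 \<otimes> b2) = scl (ssign p p') (amul q a1 b1 \<otimes> amul q a2 b2)"
proof -
  note s = tmul_def amul_def bilin_simps tensor_def lin_add lin_scl
  have 1: "tmul q (bas i \<otimes> bas j) (bas k \<otimes> b2)
      = scl (ssign (parity j) (parity k)) (amul q (bas i) (bas k) \<otimes> amul q (bas j) b2)" for i j k
    by (rule fun_cong[where x = b2], rule linear_ext[where S = scl])
      (unfold_locales; simp add: s scl.scale_right_distrib mult.commute)+
  have 2: "tmul q (a1 \<otimes> bas j) (bas k \<otimes> b2)
      = scl (ssign (parity j) (parity k)) (amul q a1 (bas k) \<otimes> amul q (bas j) b2)" for j k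
    by (rule fun_cong[where x = a1], rule linear_ext[where S = scl])
      (use 1 in \<open>unfold_locales; simp add: s scl.scale_right_distrib mult.commute\<close>)+
  have 3: "tmul q (a1 \<otimes> bas j) (b1 \<otimes> b2)
      = scl (ssign (parity j) p') (amul q a1 b1 \<otimes> amul q (bas j) b2)" for j
    using assms(2)
  proof (induction b1 rule: homogeneous_induct)
    case (bas c i)
    then show ?case using 2[of j i]
      by (simp add: s scl.scale_right_distrib mult.commute)
  qed (simp_all add: s scl.scale_right_distrib)
  show ?thesis
    using assms(1)
  proof (induction a2 rule: homogeneous_induct)
    case (bas c i)
    then show ?case using 3[of i]
      by (simp add: s scl.scale_right_distrib mult.commute)
  qed (simp_all add: s scl.scale_right_distrib)
qed

lemma homogeneous_bmul: "homogeneous (parity i \<noteq> parity j) (bmul q i j)"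
  by (cases i; cases j) (auto simp: homogeneous_def)

lemma homogeneous_bas: "homogeneous p (bas i) \<longleftrightarrow> parity i = p"
  by (simp add: homogeneous_def bas_def)

lemma tensor_calgebra:
  assumes "q \<noteq> 0"
  shows "calgebra scl (tmul q) tone"
proof -
  interpret A: calgebra scl "amul q" aone by (rule superplane_calgebra) fact
  have scl_tmul: "tmul q (scl c a) b = scl c (tmul q a b)" "tmul q a (scl c b) = scl c (tmul q a b)"
    for a b c by (simp_all add: tmul_def bilin_simps)
  show ?thesis
  proof unfold_locales
    fix a b c :: "idx \<times> idx \<Rightarrow>\<^sub>0 complex"
    show "tmul q (tmul q a b) c = tmul q a (tmul q b c)"
    proof (rule trilinear_ext[OF tmul_def])
      fix i j k :: "idx \<times> idx"
      obtain i1 i2 j1 j2 k1 k2 where ijk: "i = (i1, i2)" "j = (j1, j2)" "k = (k1, k2)"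
        by (metis surj_pair)
      let ?p = "parity"
      have "tmul q (tmul q (bas i) (bas j)) (bas k) = scl (ssign (?p i2) (?p j1))
          (tmul q (bmul q i1 j1 \<otimes> bmul q i2 j2) (bas k1 \<otimes> bas k2))"
        by (simp add: ijk tmul_bas scl_tmul)
      also have "\<dots> = scl (ssign (?p i2) (?p j1) * ssign (?p i2 \<noteq> ?p j2) (?p k1))
          (amul q (bmul q i1 j1) (bas k1) \<otimes> amul q (bmul q i2 j2) (bas k2))"
        by (subst tmul_tensor[OF homogeneous_bmul, of "?p k1"]) (simp_all add: homogeneous_bas)
      also have "\<dots> = scl (ssign (?p j2) (?p k1) * ssign (?p i2) (?p j1 \<noteq> ?p k1))
          (amul q (bas i1) (bmul q j1 k1) \<otimes> amul q (bas i2) (bmul q j2 k2))"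
        by (simp flip: amul_bas add: A.assoc) (simp add: ssign_def)
      also have "\<dots> = scl (ssign (?p j2) (?p k1))
          (tmul q (bas i1 \<otimes> bas i2) (bmul q j1 k1 \<otimes> bmul q j2 k2))"
        by (subst tmul_tensor[of "?p i2", OF _ homogeneous_bmul]) (simp_all add: homogeneous_bas)
      also have "\<dots> = tmul q (bas i) (tmul q (bas j) (bas k))"
        by (simp add: ijk tmul_bas scl_tmul)
      finally show "tmul q (tmul q (bas i) (bas j)) (bas k)
          = tmul q (bas i) (tmul q (bas j) (bas k))" .
    qed
    have "tmul q tone (bas i) = bas i" "tmul q (bas i) tone = bas i" for i
      by (cases i; cases "fst i"; cases "snd i";
          simp add: tmul_bas tone_def aone_def single_eq_scl_bas tensor_simps ssign_def)+
    from unit_ext[OF tmul_def this] show "tmul q tone a = a" "tmul q a tone = a" .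
  qed (simp_all add: tmul_def bilin_simps)
qed

definition is_coproduct :: "complex \<Rightarrow> (superplane \<Rightarrow> (idx \<times> idx \<Rightarrow>\<^sub>0 complex)) \<Rightarrow> bool" where
  "is_coproduct q \<Delta> \<longleftrightarrow> alg_hom scl (amul q) aone scl (tmul q) tone \<Delta> \<and>
     \<Delta> gx = gx \<otimes> gx \<and> \<Delta> gy = gy \<otimes> gy \<and>
     \<Delta> gtheta = gtheta \<otimes> amul q gx_inv gy + aone \<otimes> gtheta"

definition coproduct :: "complex \<Rightarrow> superplane \<Rightarrow> (idx \<times> idx \<Rightarrow>\<^sub>0 complex)" where
  "coproduct q = (THE \<Delta>. is_coproduct q \<Delta>)"

theorem coproduct_ex1:
  assumes "q \<noteq> 0"
  shows "\<exists>!\<Delta>. is_coproduct q \<Delta>"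
  unfolding is_coproduct_def
proof (rule superplane_universal[OF assms tensor_calgebra[OF assms]])
  show "superplane_relations scl (tmul q) tone q (gx \<otimes> gx) (gx_inv \<otimes> gx_inv)
     (gy \<otimes> gy) (gy_inv \<otimes> gy_inv) (gtheta \<otimes> amul q gx_inv gy + aone \<otimes> gtheta)"
    using assms
    by (simp add: superplane_relations_def tmul_def amul_def gx_def gx_inv_def gy_def gy_inv_def
        gtheta_def aone_def tone_def ssign_def single_eq_scl_bas bilin_simps tensor_simps
        power_int_minus scl.scale_right_distrib)
qed

corollary is_coproduct_coproduct: "q \<noteq> 0 \<Longrightarrow> is_coproduct q (coproduct q)"
  unfolding coproduct_def by (rule theI'[of "is_coproduct q"]) (rule coproduct_ex1)


section \<open>The dual algebra\<close>

definition dual :: "(superplane \<Rightarrow> complex) set" where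
  "dual = {u. Vector_Spaces.linear scl (*) u}"

text \<open>A functional is homogeneous of parity \<open>p\<close> if it vanishes on the elements of the other parity.\<close>

definition dual_part :: "bool \<Rightarrow> (superplane \<Rightarrow> complex) set" where
  "dual_part p = {u \<in> dual. \<forall>a. homogeneous (\<not> p) a \<longrightarrow> u a = 0}"

text \<open>
  The functional \<open>u \<otimes> v\<close> on the tensor square.  On basis vectors the sign
  \<open>(-1)\<^bsup>p(v)p(a)\<^esup>\<close> is written with the parity of the second argument instead of \<open>p(v)\<close>:
  a homogeneous \<open>v\<close> vanishes unless the two agree (lemma \<open>tpair_tensor\<close>), and this form is also
  linear in \<open>v\<close>.
\<close>

definition tpair :: "(superplane \<Rightarrow> complex) \<Rightarrow> (superplane \<Rightarrow> complex) \<Rightarrow>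
    (idx \<times> idx \<Rightarrow>\<^sub>0 complex) \<Rightarrow> complex" where
  "tpair u v t = (\<Sum>(i, j)\<in>Poly_Mapping.keys t.
     Poly_Mapping.lookup t (i, j) * (ssign (parity j) (parity i) * u (bas i) * v (bas j)))"

definition uprod :: "complex \<Rightarrow> (superplane \<Rightarrow> complex) \<Rightarrow> (superplane \<Rightarrow> complex) \<Rightarrow>
    (superplane \<Rightarrow> complex)" where
  "uprod q u v = (\<lambda>a. tpair u v (coproduct q a))"

lemma vector_space_complex: "vector_space ((*) :: complex \<Rightarrow> complex \<Rightarrow> complex)"
  by standard (auto simp: algebra_simps)

lemma
  shows linear_tpair: "Vector_Spaces.linear scl (*) (tpair u v)"
    and tpair_bas: "tpair u v (bas (i, j)) = ssign (parity j) (parity i) * u (bas i) * v (bas j)"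
proof -
  define f where "f = (\<lambda>(i, j). ssign (parity j) (parity i) * u (bas i) * v (bas j))"
  have eq: "tpair u v = (\<lambda>t. \<Sum>ij\<in>Poly_Mapping.keys t. Poly_Mapping.lookup t ij * f ij)"
    unfolding tpair_def f_def by (intro ext sum.cong) auto
  show "Vector_Spaces.linear scl (*) (tpair u v)"
    unfolding eq by (rule linear_extend(1)[OF vector_space_complex, of f])
  have "tpair u v (bas (i, j)) = f (i, j)"
    unfolding eq by (rule linear_extend(2)[OF vector_space_complex, of "(i, j)" f])
  then show "tpair u v (bas (i, j)) = ssign (parity j) (parity i) * u (bas i) * v (bas j)"
    by (simp add: f_def)
qed

lemma tpair_tensor:
  assumes u: "u \<in> dual" and v: "v \<in> dual_part p" and a: "homogeneous p' a"
  shows "tpair u v (a \<otimes> b) = ssign p p' * u a * v b"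
proof -
  interpret t: Vector_Spaces.linear scl "(*)" "tpair u v" by (rule linear_tpair)
  interpret u: Vector_Spaces.linear scl "(*)" u using u by (simp add: dual_def)
  interpret v: Vector_Spaces.linear scl "(*)" v using v by (simp add: dual_part_def dual_def)
  have v0: "v (bas j) = 0" if "parity j \<noteq> p" for j
    using v that by (auto simp: dual_part_def homogeneous_def bas_def)
  have 1: "tpair u v (bas i \<otimes> bas j) = ssign p (parity i) * u (bas i) * v (bas j)" for i j
    using v0[of j] by (cases "parity j = p") (simp_all add: tpair_bas)
  have 2: "tpair u v (bas i \<otimes> b) = ssign p (parity i) * u (bas i) * v b" for i
  proof -
    have "(\<lambda>b. tpair u v (bas i \<otimes> b)) = (\<lambda>b. ssign p (parity i) * u (bas i) * v b)"
    proof (rule linear_ext)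
      show "Vector_Spaces.linear scl (*) (\<lambda>b. tpair u v (bas i \<otimes> b))"
        by unfold_locales (simp_all add: tensor_simps t.add t.scale)
      show "Vector_Spaces.linear scl (*) (\<lambda>b. ssign p (parity i) * u (bas i) * v b)"
        by unfold_locales (simp_all add: v.add v.scale distrib_left)
    qed (rule 1)
    then show ?thesis by (rule fun_cong)
  qed
  show ?thesis
    using a
  proof (induction a rule: homogeneous_induct)
    case (add a a')
    then show ?case by (simp add: tensor_simps t.add u.add distrib_left distrib_right)
  next
    case (bas c i)
    then show ?case using 2[of i] by (simp add: tensor_simps t.scale u.scale)
  qed simp
qed

lemma uprod_dual:
  assumes "q \<noteq> 0"
  shows "uprod q u v \<in> dual"
proof -
  interpret t: Vector_Spaces.linear scl "(*)" "tpair u v" by (rule linear_tpair)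
  interpret d: Vector_Spaces.linear scl scl "coproduct q"
    using is_coproduct_coproduct[OF assms] by (simp add: is_coproduct_def alg_hom_def)
  show ?thesis
    unfolding dual_def uprod_def mem_Collect_eq
    by unfold_locales (simp_all add: d.add d.scale t.add t.scale)
qed

text \<open>Functionals are determined by arbitrary values on the monomials; in particular the functionals
  \<open>X\<close>, \<open>Y\<close> (even) and \<open>\<nabla>\<close> (odd) below exist and are unique.\<close>

lemma dual_ex1:
  assumes "q \<noteq> 0"
  shows "\<exists>!u. u \<in> dual \<and> (\<forall>m n. \<forall>k\<in>{0, 1}. u (monomial q m n k) = f m n k)"
proof -
  define g where "g = (\<lambda>(m, n, k). f m n (if k then 1 else 0 :: nat))"
  define w where "w a = (\<Sum>i\<in>Poly_Mapping.keys a. Poly_Mapping.lookup a i * g i)" for a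
  have w: "Vector_Spaces.linear scl (*) w" "w (bas i) = g i" for i
    unfolding w_def by (rule linear_extend, rule vector_space_complex)+
  have eq: "(\<forall>m n. \<forall>k\<in>{0, 1}. u (monomial q m n k) = f m n k) \<longleftrightarrow> (\<forall>i. u (bas i) = g i)" for u
  proof -
    have "(\<forall>m n. \<forall>k\<in>{0, 1}. u (monomial q m n k) = f m n k) \<longleftrightarrow>
        (\<forall>m n. u (bas (m, n, False)) = f m n 0 \<and> u (bas (m, n, True)) = f m n 1)"
      by (simp add: monomial_eq_bas[OF assms, simplified])
    then show ?thesis
      by (simp add: g_def all_bool_eq conj_commute)
  qed
  show ?thesis
    unfolding eq dual_def mem_Collect_eq
  proof (rule ex1I[of _ w])
    show "u = w" if "Vector_Spaces.linear scl (*) u \<and> (\<forall>i. u (bas i) = g i)" for u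
      using that w by (intro linear_ext[where S = "(*)"]) auto
  qed (use w in simp)
qed

lemma generators_exist:
  assumes "q \<noteq> 0"
  shows "\<exists>X\<in>dual_part False. \<forall>m n. \<forall>k\<in>{0, 1}.
           X (monomial q m n k) = of_int m * of_bool (k = 0)"
    and "\<exists>Y\<in>dual_part False. \<forall>m n. \<forall>k\<in>{0, 1}.
           Y (monomial q m n k) = of_int n * of_bool (k = 0)"
    and "\<exists>N\<in>dual_part True. \<forall>m n. \<forall>k\<in>{0, 1}.
           N (monomial q m n k) = of_bool (k = 1)"
proof -
  have part: "u \<in> dual_part p"
    if u: "u \<in> dual" and z: "\<And>m n. u (monomial q m n (if p then 0 else 1)) = 0" for u p
  proof -
    interpret u: Vector_Spaces.linear scl "(*)" u using u by (simp add: dual_def)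
    have z': "u (bas i) = 0" if "parity i = (\<not> p)" for i
    proof -
      obtain m n k where "i = (m, n, k)" by (metis prod_cases3)
      then show ?thesis
        using that z[of m n] monomial_eq_bas[OF assms, of m n] by (cases p) auto
    qed
    have "u a = 0" if "homogeneous (\<not> p) a" for a
      using that by (induction rule: homogeneous_induct) (auto simp: u.add u.scale z')
    then show ?thesis using u by (simp add: dual_part_def)
  qed
  obtain X where X: "X \<in> dual"
      "\<And>m n k. k \<in> {0, 1} \<Longrightarrow> X (monomial q m n k) = of_int m * of_bool (k = 0)"
    using ex1_implies_ex[OF dual_ex1[OF assms, of "\<lambda>m n k. of_int m * of_bool (k = 0)"]] by blast
  have "X \<in> dual_part False"
    by (rule part) (simp_all add: X)
  with X(2) show "\<exists>X\<in>dual_part False. \<forall>m n. \<forall>k\<in>{0, 1}.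
      X (monomial q m n k) = of_int m * of_bool (k = 0)"
    by blast
  obtain Y where Y: "Y \<in> dual"
      "\<And>m n k. k \<in> {0, 1} \<Longrightarrow> Y (monomial q m n k) = of_int n * of_bool (k = 0)"
    using ex1_implies_ex[OF dual_ex1[OF assms, of "\<lambda>m n k. of_int n * of_bool (k = 0)"]] by blast
  have "Y \<in> dual_part False"
    by (rule part) (simp_all add: Y)
  with Y(2) show "\<exists>Y\<in>dual_part False. \<forall>m n. \<forall>k\<in>{0, 1}.
      Y (monomial q m n k) = of_int n * of_bool (k = 0)"
    by blast
  obtain N where N: "N \<in> dual"
      "\<And>m n k. k \<in> {0, 1} \<Longrightarrow> N (monomial q m n k) = of_bool (k = 1)"
    using ex1_implies_ex[OF dual_ex1[OF assms, of "\<lambda>m n k. of_bool (k = 1)"]] by blast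
  have "N \<in> dual_part True"
    by (rule part) (simp_all add: N)
  with N(2) show "\<exists>N\<in>dual_part True. \<forall>m n. \<forall>k\<in>{0, 1}.
      N (monomial q m n k) = of_bool (k = 1)"
    by blast
qed

end

theory Submission
  imports Defs
begin

text \<open>
  The monomial \<open>x\<^sup>m y\<^sup>n\<close> is group-like, hence
  \<open>\<Delta>(x\<^sup>m y\<^sup>n \<theta>) = x\<^sup>m y\<^sup>n \<theta> \<otimes> x\<^bsup>m-1\<^esup> y\<^bsup>n+1\<^esup> + x\<^sup>m y\<^sup>n \<otimes> x\<^sup>m y\<^sup>n \<theta>\<close>.  On
  \<open>x\<^sup>m y\<^sup>n \<theta>\<close> the second term gives \<open>XN\<close> the value \<open>m\<close> and the first gives \<open>NX\<close> the value
  \<open>m - 1\<close>; for \<open>Y\<close> the values are \<open>n\<close> and \<open>n + 1\<close>.  The shifts by \<open>x\<^sup>-\<^sup>1 y\<close> are the commutators.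
\<close>

lemma dual_eqI:
  assumes "u \<in> dual" "v \<in> dual" "\<And>i. u (bas i) = v (bas i)"
  shows "u = v"
  using assms by (intro linear_ext[where S = "(*)"]) (auto simp: dual_def)

text \<open>The closure properties of \<open>dual\<close> put both sides of each relation into
  \<open>dual\<close>, where \<open>dual_eqI\<close> reduces equality to values on basis
  vectors.\<close>

lemma dual_diff:
  assumes "u \<in> dual" "v \<in> dual"
  shows "u - v \<in> dual"
proof -
  interpret u: Vector_Spaces.linear scl "(*)" u using assms by (simp add: dual_def)
  interpret v: Vector_Spaces.linear scl "(*)" v using assms by (simp add: dual_def)
  show ?thesis
    unfolding dual_def mem_Collect_eq
    by unfold_locales (simp_all add: u.add u.scale v.add v.scale algebra_simps)
qed

lemma dual_zero: "0 \<in> dual"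
  unfolding dual_def mem_Collect_eq
  by (simp add: Vector_Spaces.linear_iff vector_space_complex scl.vector_space_axioms)

lemma dual_uminus: "u \<in> dual \<Longrightarrow> - u \<in> dual"
  using dual_diff[OF dual_zero] by simp

text \<open>The left factor is free of \<theta>, so nothing odd moves past anything: neither a sign
  nor a power of \<open>q\<close> appears, and the exponents just add in each leg.\<close>

lemma tmul_grouplike:
  "tmul q (bas (m, n, False) \<otimes> bas (m, n, False)) (bas (m', n', k) \<otimes> bas (m'', n'', k'))
    = bas (m + m', n + n', k) \<otimes> bas (m + m'', n + n'', k')"
  by (simp add: tmul_bas single_eq_scl_bas ssign_def)

context
  fixes q :: complex
  assumes q: "q \<noteq> 0"
begin

lemma coproduct_amul: "coproduct q (amul q a b) = tmul q (coproduct q a) (coproduct q b)"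
  and coproduct_aone: "coproduct q aone = tone"
  and coproduct_gx: "coproduct q gx = gx \<otimes> gx"
  and coproduct_gy: "coproduct q gy = gy \<otimes> gy"
  and coproduct_gtheta: "coproduct q gtheta = gtheta \<otimes> amul q gx_inv gy + aone \<otimes> gtheta"
  using is_coproduct_coproduct[OF q] by (simp_all add: is_coproduct_def alg_hom_def)

text \<open>The exponents \<open>(m, n)\<close> of group-like monomials form a subgroup of the
  integer lattice, and it contains \<open>(1, 0)\<close> and \<open>(0, 1)\<close>.\<close>

lemma coproduct_grouplike:
  "coproduct q (bas (m, n, False)) = bas (m, n, False) \<otimes> bas (m, n, False)"
proof -
  interpret T: calgebra scl "tmul q" tone by (rule tensor_calgebra[OF q])
  define G where "G m n \<longleftrightarrow>
    coproduct q (bas (m, n, False)) = bas (m, n, False) \<otimes> bas (m, n, False)" for m n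
  have mult: "coproduct q (bas (m + m', n + n', False))
      = tmul q (coproduct q (bas (m, n, False))) (coproduct q (bas (m', n', False)))" for m n m' n'
    by (simp flip: coproduct_amul add: amul_bas single_eq_scl_bas)
  have tone: "tone = bas (0, 0, False) \<otimes> bas (0, 0, False)"
    by (simp add: tone_def aone_def)
  have zero: "G 0 0"
    using coproduct_aone by (simp add: G_def tone aone_def)
  have add: "G (m + m') (n + n')" if "G m n" "G m' n'" for m n m' n'
    using that mult[of m m' n n'] by (simp add: G_def tmul_grouplike del: bas_tensor_bas)
  \<comment> \<open>The coproduct is prescribed on \<open>gx\<close> and \<open>gy\<close> but not
    on their inverses. Here the unknown value is a right inverse of \<open>?e m n\<close>, hence
    equal to its left inverse \<open>?e (- m) (- n)\<close>.\<close>
  have neg: "G (- m) (- n)" if "G m n" for m n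
  proof -
    let ?e = "\<lambda>m n. bas (m, n, False) \<otimes> bas (m, n, False)"
    have "tmul q (?e m n) (coproduct q (bas (- m, - n, False))) = tone"
      using mult[of m "- m" n "- n"] that zero by (simp add: G_def tone)
    then have "tmul q (?e (- m) (- n)) (tmul q (?e m n) (coproduct q (bas (- m, - n, False))))
        = ?e (- m) (- n)"
      by (simp del: bas_tensor_bas)
    moreover have "tmul q (?e (- m) (- n)) (?e m n) = tone"
      by (simp add: tmul_grouplike tone del: bas_tensor_bas)
    ultimately show ?thesis
      by (simp add: G_def T.inv_cancel del: bas_tensor_bas)
  qed
  have x: "G 1 0" and y: "G 0 1"
    using coproduct_gx coproduct_gy by (simp_all add: G_def gx_def gy_def)
  have "G m 0"
  proof (induction m rule: int_induct[where k = 0])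
    case (step1 i)
    then show ?case using add[OF _ x] by simp
  next
    case (step2 i)
    then show ?case using add[OF _ neg[OF x], of i 0] by simp
  qed (rule zero)
  moreover have "G 0 n"
  proof (induction n rule: int_induct[where k = 0])
    case (step1 i)
    then show ?case using add[OF _ y] by simp
  next
    case (step2 i)
    then show ?case using add[OF _ neg[OF y], of 0 i] by simp
  qed (rule zero)
  ultimately have "G m n"
    using add[of m 0 0 n] by simp
  then show ?thesis
    by (simp only: G_def)
qed

text \<open>With \<theta> written last, the group-like part multiplies the coproduct of \<theta>
  from the left and shifts both legs of each term by \<open>(m, n)\<close>.\<close>

lemma coproduct_theta:
  "coproduct q (bas (m, n, True)) = bas (m, n, True) \<otimes> bas (m - 1, n + 1, False)
    + bas (m, n, False) \<otimes> bas (m, n, True)"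
proof -
  interpret T: calgebra scl "tmul q" tone by (rule tensor_calgebra[OF q])
  have "bas (m, n, True) = amul q (bas (m, n, False)) gtheta"
    by (simp add: gtheta_def amul_bas single_eq_scl_bas)
  moreover have "coproduct q gtheta = bas (0, 0, True) \<otimes> bas (-1, 1, False)
      + bas (0, 0, False) \<otimes> bas (0, 0, True)"
    unfolding coproduct_gtheta
    by (simp add: gtheta_def gx_inv_def gy_def aone_def amul_bas single_eq_scl_bas)
  ultimately show ?thesis
    by (simp add: coproduct_amul coproduct_grouplike T.add_right tmul_grouplike
        del: bas_tensor_bas)
qed

lemma uprod_grouplike:
  "uprod q u v (bas (m, n, False)) = u (bas (m, n, False)) * v (bas (m, n, False))"
  by (simp add: uprod_def coproduct_grouplike tpair_bas ssign_def)

text \<open>In either term of the coproduct one leg is even, so the pairing contributes no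
  sign.\<close>

lemma uprod_theta:
  "uprod q u v (bas (m, n, True)) = u (bas (m, n, True)) * v (bas (m - 1, n + 1, False))
    + u (bas (m, n, False)) * v (bas (m, n, True))"
proof -
  interpret t: Vector_Spaces.linear scl "(*)" "tpair u v" by (rule linear_tpair)
  show ?thesis
    by (simp add: uprod_def coproduct_theta t.add tpair_bas ssign_def)
qed

end

theorem theorem5p5:
  fixes q :: complex and X Y N :: "superplane \<Rightarrow> complex"
  assumes "q \<noteq> 0"
    and "X \<in> dual_part False" and "Y \<in> dual_part False" and "N \<in> dual_part True"
    and "\<And>m n k. k \<in> {0, 1} \<Longrightarrow> X (monomial q m n k) = of_int m * of_bool (k = 0)"
    and "\<And>m n k. k \<in> {0, 1} \<Longrightarrow> Y (monomial q m n k) = of_int n * of_bool (k = 0)"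
    and "\<And>m n k. k \<in> {0, 1} \<Longrightarrow> N (monomial q m n k) = of_bool (k = 1)"
  shows "uprod q X Y - uprod q Y X = 0 \<and>
    uprod q X N - uprod q N X = N \<and>
    uprod q Y N - uprod q N Y = - N \<and>
    uprod q N N = 0"
proof -
  have dual: "N \<in> dual"
    using assms(4) by (simp add: dual_part_def)
  have even: "X (bas (m, n, False)) = of_int m" "Y (bas (m, n, False)) = of_int n"
      "N (bas (m, n, False)) = 0" for m n
    using assms(5-7)[of 0 m n] by (simp_all add: monomial_eq_bas[OF assms(1)])
  have odd: "X (bas (m, n, True)) = 0" "Y (bas (m, n, True)) = 0"
      "N (bas (m, n, True)) = 1" for m n
    using assms(5-7)[of 1 m n] by (simp_all add: monomial_eq_bas[OF assms(1), simplified])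
  note eval_simps = even odd uprod_grouplike[OF assms(1)] uprod_theta[OF assms(1)]
  have eqI: "u = v"
    if "u \<in> dual" "v \<in> dual" "\<And>m n. u (bas (m, n, False)) = v (bas (m, n, False))"
      "\<And>m n. u (bas (m, n, True)) = v (bas (m, n, True))" for u v
    using that(1,2)
  proof (rule dual_eqI)
    fix i :: idx
    show "u (bas i) = v (bas i)"
      using that(3,4) by (cases i; cases "snd (snd i)") auto
  qed
  show ?thesis
    \<comment> \<open>For the square of \<open>N\<close>, each summand in \<open>uprod_theta\<close>
      has a factor \<open>N\<close> evaluated on a monomial without \<theta>, which is 0.\<close>
    by (intro conjI eqI uprod_dual dual_diff dual_zero dual_uminus dual assms(1))
      (simp_all add: eval_simps)
qed

end
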